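(* Let $(X,d)$ be a finite ultrametric space with $n$ points, where $n\ge 2$. Then $1\le \dim_1(X)\le n-1$ and $2\le\dim_2(X)\le n$.
   Context: A metric space $(X,d)$ is ultrametric if $d(x,y)\le\max\{d(x,z),d(z,y)\}$ for all $x,y,z\in X$. Points $x,y\in X$ are distinguished by $z\in X$ if $d(x,z)\neq d(y,z)$. For a positive integer $k$, a set $S\subseteq X$ is a $k$-metric generator for $X$ if any pair of different points of $X$ is distinguished by at least $k$ elements of $S$. A $k$-metric basis is a $k$-metric generator of minimum cardinality in $X$, and $\dim_k(X)$ denotes the cardinality of any $k$-metric basis. *)

theory Defs
  imports "HOL-Analysis.Abstract_Metric_Spaces" "HOL-Library.Equipollence"
begin

locale Ultrametric_space = Metric_space M d
  for M :: "'a set" and d :: "'a \<Rightarrow> 'a \<Rightarrow> real" +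
  assumes ultrametric:
    "\<lbrakk>x \<in> M; y \<in> M; z \<in> M\<rbrakk> \<Longrightarrow> d x y \<le> max (d x z) (d z y)"

definition distinguishes :: "('a \<Rightarrow> 'a \<Rightarrow> real) \<Rightarrow> 'a \<Rightarrow> 'a \<Rightarrow> 'a \<Rightarrow> bool" where
  "distinguishes d z x y \<longleftrightarrow> d x z \<noteq> d y z"

(* "At least k elements" is phrased by a k-element subset, because card is 0 on infinite sets. *)
definition k_metric_generator ::
    "'a set \<Rightarrow> ('a \<Rightarrow> 'a \<Rightarrow> real) \<Rightarrow> nat \<Rightarrow> 'a set \<Rightarrow> bool" where
  "k_metric_generator M d k S \<longleftrightarrow>
     S \<subseteq> M \<and>
     (\<forall>x\<in>M. \<forall>y\<in>M. x \<noteq> y \<longrightarrow>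
        (\<exists>T \<subseteq> {z \<in> S. distinguishes d z x y}. finite T \<and> card T = k))"

(* Cardinalities are compared by lepoll, so that infinite generators do not count as small. *)
definition k_metric_basis ::
    "'a set \<Rightarrow> ('a \<Rightarrow> 'a \<Rightarrow> real) \<Rightarrow> nat \<Rightarrow> 'a set \<Rightarrow> bool" where
  "k_metric_basis M d k S \<longleftrightarrow>
     k_metric_generator M d k S \<and> (\<forall>T. k_metric_generator M d k T \<longrightarrow> S \<lesssim> T)"

(* The common cardinality of all k-metric bases; unspecified if there is no k-metric basis.
   Since card is a natural number, this is meaningful only when the bases are finite, in
   particular when M is finite. *)
definition k_metric_dim :: "'a set \<Rightarrow> ('a \<Rightarrow> 'a \<Rightarrow> real) \<Rightarrow> nat \<Rightarrow> nat" where
  "k_metric_dim M d k = (THE m. \<exists>S. k_metric_basis M d k S \<and> card S = m)"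

end

theory Submission
  imports Defs
begin

text \<open>A point \<open>z\<close> lies at distance zero from itself and at positive distance from every other point,
  so two different points always distinguish their own pair.  The whole space is therefore a
  \<open>2\<close>-metric generator.  If one point \<open>p\<close> is removed, every pair of different points still keeps a
  member, so the remaining \<open>n - 1\<close> points form a \<open>1\<close>-metric generator.  These two generators bound
  the dimensions from above.

  For the lower bounds, a space with two different points contains a pair that has to be
  distinguished, and this alone forces at least \<open>k\<close> elements into every \<open>k\<close>-metric generator.  Lemma
  \<open>k_metric_dim_attained\<close> transfers both bounds to the dimension.\<close>

lemma (in Metric_space) distinguishes_own_pair:
  assumes "x \<in> M" "y \<in> M" "x \<noteq> y"
  shows "distinguishes d x x y" "distinguishes d y x y"
  using assms by (auto simp: distinguishes_def)

lemma (in Metric_space) whole_space_2_generator: "k_metric_generator M d 2 M"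
  unfolding k_metric_generator_def
proof (intro conjI ballI impI)
  fix x y assume "x \<in> M" "y \<in> M" "x \<noteq> y"
  then show "\<exists>T\<subseteq>{z \<in> M. distinguishes d z x y}. finite T \<and> card T = 2"
    by (intro exI[of _ "{x, y}"]) (auto intro: distinguishes_own_pair)
qed simp

lemma (in Metric_space) delete_point_1_generator: "k_metric_generator M d 1 (M - {p})"
  unfolding k_metric_generator_def
proof (intro conjI ballI impI)
  fix x y assume xy: "x \<in> M" "y \<in> M" "x \<noteq> y"
  then obtain z where "z \<in> {x, y}" "z \<noteq> p" by blast
  with xy show "\<exists>T\<subseteq>{z \<in> M - {p}. distinguishes d z x y}. finite T \<and> card T = 1"
    by (intro exI[of _ "{z}"]) (auto intro: distinguishes_own_pair)
qed blast

lemma finite_k_metric_generator: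
  assumes "k_metric_generator M d k S" "finite M"
  shows "finite S"
proof -
  from assms(1) have "S \<subseteq> M" unfolding k_metric_generator_def by (rule conjunct1)
  with assms(2) show ?thesis by (rule rev_finite_subset)
qed

lemma k_metric_generator_card_ge:
  assumes "k_metric_generator M d k S" "finite S" "x \<in> M" "y \<in> M" "x \<noteq> y"
  shows "k \<le> card S"
proof -
  from assms obtain T where "T \<subseteq> {z \<in> S. distinguishes d z x y}" "card T = k"
    unfolding k_metric_generator_def by blast
  then have "T \<subseteq> S" by blast
  with \<open>finite S\<close> \<open>card T = k\<close> show ?thesis using card_mono by metis
qed

text \<open>In a finite space comparison by \<open>\<lesssim>\<close> is comparison of cardinalities, so a generator with the
  fewest elements is a basis and all bases have its cardinality.  This makes the definite
  description in \<open>k_metric_dim\<close> denote an actual minimum.\<close>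

lemma k_metric_dim_attained:
  assumes "finite M" and G: "k_metric_generator M d k G"
  obtains S where "k_metric_generator M d k S" "card S = k_metric_dim M d k" "card S \<le> card G"
proof -
  have fin: "finite T" if "k_metric_generator M d k T" for T
    using that \<open>finite M\<close> by (rule finite_k_metric_generator)
  define S where "S = arg_min card (k_metric_generator M d k)"
  have S: "k_metric_generator M d k S"
    unfolding S_def using G by (rule arg_min_natI)
  have least: "card S \<le> card T" if "k_metric_generator M d k T" for T
    unfolding S_def using that by (rule arg_min_nat_le)
  have basis: "k_metric_basis M d k S"
    unfolding k_metric_basis_def using S least fin by (simp add: lepoll_iff_card_le)
  have "card B = card S" if "k_metric_basis M d k B" for B
  proof -
    from that have B: "k_metric_generator M d k B" "B \<lesssim> S"
      unfolding k_metric_basis_def using S by blast+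
    then have "card B \<le> card S" using fin S by (simp add: lepoll_iff_card_le)
    with least[OF B(1)] show ?thesis by simp
  qed
  with basis have "k_metric_dim M d k = card S"
    unfolding k_metric_dim_def by (intro the_equality) blast+
  with S least[OF G] show thesis by (intro that) simp_all
qed

lemma k_metric_dim_bounds:
  assumes "finite M" "k_metric_generator M d k G" "x \<in> M" "y \<in> M" "x \<noteq> y"
  shows "k \<le> k_metric_dim M d k" "k_metric_dim M d k \<le> card G"
proof -
  obtain S where S: "k_metric_generator M d k S" "card S = k_metric_dim M d k" "card S \<le> card G"
    using assms(1,2) by (rule k_metric_dim_attained)
  then have "finite S"
    using \<open>finite M\<close> finite_k_metric_generator by metis
  with S assms show "k \<le> k_metric_dim M d k" "k_metric_dim M d k \<le> card G"
    using k_metric_generator_card_ge[of M d k S x y] by auto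
qed

theorem proposition2p37:
  fixes M :: "'a set" and d :: "'a \<Rightarrow> 'a \<Rightarrow> real" and n :: nat
  assumes "Ultrametric_space M d"
    and "finite M"
    and "card M = n"
    and "n \<ge> 2"
  shows "1 \<le> k_metric_dim M d 1 \<and> k_metric_dim M d 1 \<le> n - 1 \<and>
         2 \<le> k_metric_dim M d 2 \<and> k_metric_dim M d 2 \<le> n"
proof -
  interpret Ultrametric_space M d by fact
  obtain p q where pq: "p \<in> M" "q \<in> M" "p \<noteq> q"
  proof -
    have "\<not> card M \<le> Suc 0" using assms(3,4) by simp
    then show ?thesis using that card_le_Suc0_iff_eq[OF \<open>finite M\<close>] by blast
  qed
  have "card (M - {p}) = n - 1"
    using pq(1) assms(2,3) by simp
  then show ?thesis
    using k_metric_dim_bounds[OF \<open>finite M\<close> delete_point_1_generator[of p] pq]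
      k_metric_dim_bounds[OF \<open>finite M\<close> whole_space_2_generator pq] assms(3) by simp
qed

end
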